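(* Suppose $n \geq 1$ and $0 < \beta < \alpha \leq n$. Then $$M_\alpha F \leq M_\beta F$$ for all Lebesgue measurable functions $F : \mathbb{R}^n \to [0,\infty)$.
   Context: For $n \ge 1$, $0 < \alpha \leq n$, and a Lebesgue measurable function $H: \mathbb{R}^n \to [0,1]$, define $$A_\alpha(H)= \inf \Big\{ C : \int_{B(x_0,R)} H(x)\, dx \leq C R^\alpha \text{ for all } x_0 \in \mathbb{R}^n \text{ and } R \geq 1 \Big\},$$ where $B(x_0,R)$ is the closed ball of center $x_0$ and radius $R$. Such an $H$ is called a weight of dimension $\alpha$ if $A_\alpha(H) < \infty$. For a Lebesgue measurable function $F : \mathbb{R}^n \to [0,\infty)$, define $$M_\alpha F = \Big( \sup_H \frac{1}{A_\alpha(H)} \int_{\mathbb{R}^n} F(x)^\alpha H(x)\,dx \Big)^{1/\alpha} \in [0,\infty],$$ where $H$ ranges over all non-zero (i.e. not almost everywhere zero) weights on $\mathbb{R}^n$ of dimension $\alpha$. $M_\beta F$ is defined in the same way with $\beta$ in place of $\alpha$ throughout. *)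

theory Defs
  imports "HOL-Analysis.Analysis"
begin

text \<open>Real powers on \<open>[0,\<infinity>]\<close>, intended for exponents \<open>p > 0\<close>, so that \<open>\<infinity>\<close> to the power \<open>p\<close>
  is \<open>\<infinity>\<close> and \<open>0\<close> to the power \<open>p\<close> is \<open>0\<close>.\<close>

definition ennreal_powr :: "ennreal \<Rightarrow> real \<Rightarrow> ennreal" where
  "ennreal_powr x p = (if x = \<infinity> then \<infinity> else ennreal (enn2real x powr p))"

text \<open>The infimum is taken in \<open>[0,\<infinity>]\<close>. Admitting \<open>C = \<infinity>\<close> does not change it, and it equals \<open>\<infinity>\<close>
  exactly when no finite constant is admissible; for \<open>H \<ge> 0\<close> a real admissible constant is
  automatically nonnegative.\<close>

definition A_dim :: "real \<Rightarrow> (real ^ 'n \<Rightarrow> real) \<Rightarrow> ennreal" where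
  "A_dim \<alpha> H = Inf {C. \<forall>x\<^sub>0 R. R \<ge> 1 \<longrightarrow>
     (\<integral>\<^sup>+x\<in>cball x\<^sub>0 R. ennreal (H x) \<partial>lebesgue) \<le> C * ennreal (R powr \<alpha>)}"

definition weight_of_dim :: "real \<Rightarrow> (real ^ 'n \<Rightarrow> real) \<Rightarrow> bool" where
  "weight_of_dim \<alpha> H \<longleftrightarrow>
     H \<in> borel_measurable lebesgue \<and> (\<forall>x. H x \<in> {0..1}) \<and> A_dim \<alpha> H < \<infinity>"

text \<open>The division is harmless: \<open>0 < A_dim \<alpha> H < \<infinity>\<close> for every weight \<open>H\<close> in the range of the
  supremum, since \<open>A_dim \<alpha> H = 0\<close> forces \<open>H\<close> to vanish almost everywhere.\<close>

definition M_dim :: "real \<Rightarrow> (real ^ 'n \<Rightarrow> real) \<Rightarrow> ennreal" where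
  "M_dim \<alpha> F = ennreal_powr
     (SUP H \<in> {H. weight_of_dim \<alpha> H \<and> \<not> (AE x in lebesgue. H x = 0)}.
        (1 / A_dim \<alpha> H) * (\<integral>\<^sup>+x. ennreal (F x powr \<alpha> * H x) \<partial>lebesgue))
     (1 / \<alpha>)"

end

theory Submission
  imports Defs
begin

text \<open>
  Let \<open>H\<close> be a weight of dimension \<open>\<alpha>\<close> and suppose that \<open>I = \<integral> F\<^sup>\<alpha> H\<close> is finite and \<open>F\<close> bounded on
  the support of \<open>H\<close>. Hoelder's inequality on a ball of radius \<open>R\<close> gives
  \<open>\<integral> F\<^sup>\<alpha>\<^sup>-\<^sup>\<beta> H \<le> I\<^sup>1\<^sup>-\<^sup>\<theta> (A\<^sub>\<alpha>(H) R\<^sup>\<alpha>)\<^sup>\<theta>\<close> with \<open>\<theta> = \<beta>/\<alpha>\<close>, and the right-hand side is a multiple of \<open>R\<^sup>\<beta>\<close>.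
  Hence \<open>G = F\<^sup>\<alpha>\<^sup>-\<^sup>\<beta> H\<close> is, up to a scalar, a weight of dimension \<open>\<beta>\<close>. Testing \<open>M\<^sub>\<beta> F\<close> against it
  gives \<open>I = \<integral> F\<^sup>\<beta> G \<le> I\<^sup>1\<^sup>-\<^sup>\<theta> A\<^sub>\<alpha>(H)\<^sup>\<theta> (M\<^sub>\<beta> F)\<^sup>\<beta>\<close>, that is, \<open>I \<le> A\<^sub>\<alpha>(H) (M\<^sub>\<beta> F)\<^sup>\<alpha>\<close>. The extra
  assumptions are removed by cutting \<open>H\<close> off to \<open>{x. F x \<le> k \<and> norm x \<le> k}\<close> and letting \<open>k\<close> grow.
\<close>

section \<open>Hoelder's inequality from a tangent line\<close>

text \<open>Convexity of \<open>exp\<close> between 0 and \<open>ln u\<close> with weights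
  \<open>1 - p\<close> and \<open>p\<close>; the right-hand side is the tangent of
  \<open>u powr p\<close> at 1.\<close>

lemma powr_le_tangent:
  fixes u p :: real
  assumes "0 \<le> u" "0 < p" "p < 1"
  shows "u powr p \<le> (1 - p) + p * u"
proof (cases "u = 0")
  case False
  have "exp ((1 - p) *\<^sub>R 0 + p *\<^sub>R ln u) \<le> (1 - p) * exp 0 + p * exp (ln u)"
    by (rule convex_onD[OF exp_convex]) (use assms in auto)
  with False assms show ?thesis
    by (simp add: powr_def)
qed (use assms in auto)

lemma nn_integral_powr_le_Hoelder:
  fixes f h :: "'a \<Rightarrow> real" and I V p :: real
  assumes [measurable]: "f \<in> borel_measurable M" "h \<in> borel_measurable M"
    and f: "\<And>x. 0 \<le> f x" and h: "\<And>x. 0 \<le> h x"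
    and I: "(\<integral>\<^sup>+x. ennreal (f x * h x) \<partial>M) \<le> ennreal I" "0 < I"
    and V: "(\<integral>\<^sup>+x. ennreal (h x) \<partial>M) \<le> ennreal V" "0 < V"
    and p: "0 < p" "p < 1"
  shows "(\<integral>\<^sup>+x. ennreal (f x powr p * h x) \<partial>M) \<le> ennreal (I powr p * V powr (1 - p))"
proof -
  \<comment> \<open>At this scale the tangent inequality for \<open>f / s\<close> integrates to the sharp Hoelder bound.\<close>
  define s where "s = I / V"
  have s: "s > 0" using I V by (simp add: s_def)
  define a where "a = s powr p * (1 - p)"
  define b where "b = s powr p * p / s"
  have ab: "a \<ge> 0" "b \<ge> 0" using s p by (simp_all add: a_def b_def)
  have pt: "f x powr p * h x \<le> a * h x + b * (f x * h x)" for x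
  proof -
    have "f x powr p = s powr p * (f x / s) powr p"
      using s f[of x] by (simp add: powr_divide)
    also have "\<dots> \<le> s powr p * ((1 - p) + p * (f x / s))"
      by (intro mult_left_mono powr_le_tangent) (use s p f[of x] in auto)
    also have "\<dots> = a + b * f x"
      by (simp add: a_def b_def algebra_simps)
    finally have "f x powr p * h x \<le> (a + b * f x) * h x"
      by (rule mult_right_mono) (rule h)
    then show ?thesis by (simp add: algebra_simps)
  qed
  have "(\<integral>\<^sup>+x. ennreal (f x powr p * h x) \<partial>M)
      \<le> (\<integral>\<^sup>+x. (ennreal a * ennreal (h x) + ennreal b * ennreal (f x * h x)) \<partial>M)"
    using ab f h pt
    by (intro nn_integral_mono) (simp flip: ennreal_mult ennreal_plus)
  also have "\<dots> = ennreal a * (\<integral>\<^sup>+x. ennreal (h x) \<partial>M)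
      + ennreal b * (\<integral>\<^sup>+x. ennreal (f x * h x) \<partial>M)"
    by (simp add: nn_integral_add nn_integral_cmult)
  also have "\<dots> \<le> ennreal a * ennreal V + ennreal b * ennreal I"
    by (intro add_mono mult_left_mono I V) auto
  also have "\<dots> = ennreal (a * V + b * I)"
    using ab I V by (simp flip: ennreal_mult ennreal_plus)
  \<comment> \<open>Since \<open>I / s = V\<close>, the two terms are the shares
    \<open>1 - p\<close> and \<open>p\<close> of \<open>s powr p * V\<close>.\<close>
  also have "a * V + b * I = s powr p * V"
    using I V by (simp add: a_def b_def s_def field_simps)
  also have "\<dots> = I powr p * V powr (1 - p)"
    using I V by (simp add: s_def powr_divide powr_diff)
  finally show ?thesis .
qed

text \<open>For \<open>a = 0\<close> the finiteness of \<open>s\<close> forces \<open>j = 0\<close>, because \<open>1 / 0 = \<infinity>\<close>. Thus it need not be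
  shown that \<open>A_dim\<close> is positive on non-zero weights.\<close>

lemma ennreal_le_mult_if_inverse_mult_le:
  fixes a j s :: ennreal
  assumes "1 / a * j \<le> s" "s < \<infinity>" "a < \<infinity>"
  shows "j \<le> a * s"
proof (cases "a = 0")
  case True
  with assms show ?thesis
    by (cases "j = 0") (auto simp: ennreal_top_mult)
next
  case False
  have "j = a * (1 / a * j)"
    using False assms(3)
    by (metis ennreal_times_divide infinity_ennreal_def less_irrefl mult.assoc mult.commute mult.right_neutral mult_divide_eq_ennreal)
  also have "\<dots> \<le> a * s"
    by (intro mult_left_mono assms) auto
  finally show ?thesis .
qed

section \<open>Weight constants and the supremum\<close>

text \<open>A constant strictly above the infimum dominates an admissible one; strictness avoids
  asking whether the infimum is attained.\<close>

lemma A_dim_less_imp_admissible: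
  assumes "A_dim \<alpha> H < C" "1 \<le> R"
  shows "(\<integral>\<^sup>+x\<in>cball z R. ennreal (H x) \<partial>lebesgue) \<le> C * ennreal (R powr \<alpha>)"
proof -
  obtain c where "c < C" "(\<integral>\<^sup>+x\<in>cball z R. ennreal (H x) \<partial>lebesgue) \<le> c * ennreal (R powr \<alpha>)"
    using assms unfolding A_dim_def Inf_less_iff by blast
  then show ?thesis
    by (meson less_imp_le mult_right_mono order_trans zero_le)
qed

lemma A_dim_leI:
  assumes "\<And>z R. 1 \<le> R \<Longrightarrow>
    (\<integral>\<^sup>+x\<in>cball z R. ennreal (H x) \<partial>lebesgue) \<le> C * ennreal (R powr \<alpha>)"
  shows "A_dim \<alpha> H \<le> C"
  unfolding A_dim_def using assms by (intro Inf_lower) auto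

lemma ennreal_powr_mono: "x \<le> y \<Longrightarrow> 0 \<le> p \<Longrightarrow> ennreal_powr x p \<le> ennreal_powr y p"
  unfolding ennreal_powr_def
  by (auto simp: top_unique less_top intro!: ennreal_leI powr_mono2 enn2real_mono)

text \<open>This is the quantity under the outer root in \<open>M_dim\<close>, named so that its
  finite and infinite values can be treated separately.\<close>

definition M_dim_sup :: "real \<Rightarrow> (real ^ 'n \<Rightarrow> real) \<Rightarrow> ennreal" where
  "M_dim_sup \<alpha> F = (SUP H \<in> {H. weight_of_dim \<alpha> H \<and> \<not> (AE x in lebesgue. H x = 0)}.
        (1 / A_dim \<alpha> H) * (\<integral>\<^sup>+x. ennreal (F x powr \<alpha> * H x) \<partial>lebesgue))"

text \<open>Almost everywhere zero weights, excluded from the supremum, are covered too, so the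
  bound applies to a constructed weight whether or not it vanishes.\<close>

lemma nn_integral_weight_le:
  fixes F :: "real ^ 'n \<Rightarrow> real"
  assumes G: "weight_of_dim \<beta> G" and S: "M_dim_sup \<beta> F < \<infinity>"
  shows "(\<integral>\<^sup>+x. ennreal (F x powr \<beta> * G x) \<partial>lebesgue) \<le> A_dim \<beta> G * M_dim_sup \<beta> F"
proof (cases "AE x in lebesgue. G x = 0")
  case True
  then have "(\<integral>\<^sup>+x. ennreal (F x powr \<beta> * G x) \<partial>lebesgue) = (\<integral>\<^sup>+x. 0 \<partial>(lebesgue :: (real ^ 'n) measure))"
    by (intro nn_integral_cong_AE) auto
  then show ?thesis by simp
next
  case False
  have "1 / A_dim \<beta> G * (\<integral>\<^sup>+x. ennreal (F x powr \<beta> * G x) \<partial>lebesgue) \<le> M_dim_sup \<beta> F"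
    unfolding M_dim_sup_def by (rule SUP_upper) (use G False in auto)
  with S G show ?thesis
    by (intro ennreal_le_mult_if_inverse_mult_le) (auto simp: weight_of_dim_def)
qed

section \<open>The estimate on a truncated domain\<close>

lemma sublevel_inter_ball_lebesgue:
  fixes F :: "'a::euclidean_space \<Rightarrow> real"
  assumes [measurable]: "F \<in> borel_measurable lebesgue"
  shows "{x. F x \<le> a \<and> norm x \<le> r} \<in> sets lebesgue"
proof -
  have "{x. F x \<le> a \<and> norm x \<le> r} = {x \<in> space lebesgue. F x \<le> a} \<inter> cball 0 r"
    by auto
  also have "\<dots> \<in> sets lebesgue"
    by (intro sets.Int lmeasurable_cball[THEN fmeasurableD]) measurable
  finally show ?thesis .
qed

text \<open>The bound on \<open>F\<close> lets a multiple of F^(\<alpha>-\<beta>) H take values in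
  [0,1]; together with the bounded domain it makes the integral finite, so that a power of it can be
  cancelled. The resulting bound is independent of \<open>k\<close>.\<close>

lemma nn_integral_truncated_le:
  fixes F H :: "real ^ 'n \<Rightarrow> real" and \<alpha> \<beta> C S k :: real
  assumes \<beta>: "0 < \<beta>" "\<beta> < \<alpha>"
    and F[measurable]: "F \<in> borel_measurable lebesgue" and F0: "\<And>x. 0 \<le> F x"
    and H: "weight_of_dim \<alpha> H" and C: "A_dim \<alpha> H < ennreal C"
    and S: "M_dim_sup \<beta> F = ennreal S" "0 \<le> S" and k: "0 < k"
  shows "(\<integral>\<^sup>+x\<in>{x. F x \<le> k \<and> norm x \<le> k}. ennreal (F x powr \<alpha> * H x) \<partial>lebesgue)
    \<le> ennreal (C * S powr (\<alpha> / \<beta>))"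
proof -
  define T where "T = {x. F x \<le> k \<and> norm x \<le> k}"
  have [measurable]: "H \<in> borel_measurable lebesgue" and H01: "0 \<le> H x" "H x \<le> 1" for x
    using H by (auto simp: weight_of_dim_def)
  have T[measurable]: "T \<in> sets lebesgue"
    unfolding T_def by (rule sublevel_inter_ball_lebesgue) (rule F)
  have Tm: "emeasure lebesgue T < \<infinity>"
    using emeasure_mono[of T "cball 0 k" lebesgue] emeasure_lborel_cball_finite[of 0 k]
    by (auto simp: T_def subset_iff intro: le_less_trans)
  define J where "J = (\<integral>\<^sup>+x. ennreal (F x powr \<alpha> * H x) * indicator T x \<partial>lebesgue)"
  have "J \<le> (\<integral>\<^sup>+x. ennreal (k powr \<alpha>) * indicator T x \<partial>lebesgue)"
    unfolding J_def
  proof (rule nn_integral_mono)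
    fix x
    show "ennreal (F x powr \<alpha> * H x) * indicator T x \<le> ennreal (k powr \<alpha>) * indicator T x"
      using mult_mono[of "F x powr \<alpha>" "k powr \<alpha>" "H x" 1] \<beta> F0[of x] H01[of x]
        powr_mono2[of \<alpha> "F x" k]
      by (auto simp: T_def indicator_def intro!: ennreal_leI)
  qed
  also have "\<dots> < \<infinity>"
    using Tm by (simp add: nn_integral_cmult_indicator ennreal_mult_less_top)
  finally obtain I where I: "J = ennreal I" "0 \<le> I"
    by (cases J) auto
  have C0: "0 < C"
    using C by (metis ennreal_less_zero_iff le_less_trans zero_le)
  show ?thesis
  proof (cases "I = 0")
    case True
    with I show ?thesis by (simp add: J_def T_def)
  next
    case False
    with I have I0: "0 < I" by simp
    \<comment> \<open>With this exponent (F^\<alpha>)^p = F^(\<alpha>-\<beta>) and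
      (R^\<alpha>)^(1-p) = R^\<beta>.\<close>
    define p where "p = (\<alpha> - \<beta>) / \<alpha>"
    have p: "0 < p" "p < 1" "\<alpha> * p = \<alpha> - \<beta>" "1 - p = \<beta> / \<alpha>" "\<alpha> * (1 - p) = \<beta>"
      using \<beta> by (auto simp: p_def field_simps)
    \<comment> \<open>The factor making \<open>G\<close> at most 1.\<close>
    define w where "w = 1 / k powr (\<alpha> - \<beta>)"
    have w: "0 < w" using k by (simp add: w_def)
    define G where "G = (\<lambda>x. w * F x powr (\<alpha> - \<beta>) * H x * indicator T x)"
    \<comment> \<open>The Hoelder bound for mass C R^\<alpha>, scaled by \<open>w\<close> and
      stripped of its factor R^\<beta>.\<close>
    define D where "D = w * (I powr p * C powr (1 - p))"
    have D: "0 \<le> D" using w by (simp add: D_def)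
    have G01: "G x \<in> {0..1}" for x
    proof -
      have "w * F x powr (\<alpha> - \<beta>) \<le> 1" if "x \<in> T"
        using that k \<beta> F0[of x] powr_mono2[of "\<alpha> - \<beta>" "F x" k]
        by (auto simp: w_def T_def field_simps)
      then show ?thesis
        using w H01[of x] by (auto simp: G_def indicator_def intro: mult_le_one)
    qed
    have GD: "A_dim \<beta> G \<le> ennreal D"
    proof (rule A_dim_leI)
      fix z :: "real ^ 'n" and R :: real
      assume R: "1 \<le> R"
      have [measurable]: "cball z R \<in> sets lebesgue" by auto
      \<comment> \<open>Both cutoffs are absorbed into the weight; restricting to the ball only
        lowers the integral, so the same \<open>I\<close> serves every ball.\<close>
      define h where "h = (\<lambda>x. H x * indicator T x * indicator (cball z R) x)"
      have h0: "0 \<le> h x" for x using H01 by (simp add: h_def)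
      have [measurable]: "h \<in> borel_measurable lebesgue"
        unfolding h_def by measurable
      have "(\<integral>\<^sup>+x. ennreal ((F x powr \<alpha>) powr p * h x) \<partial>lebesgue)
          \<le> ennreal (I powr p * (C * R powr \<alpha>) powr (1 - p))"
      proof (rule nn_integral_powr_le_Hoelder)
        show "(\<integral>\<^sup>+x. ennreal (F x powr \<alpha> * h x) \<partial>lebesgue) \<le> ennreal I"
          unfolding I(1)[symmetric] J_def
          by (intro nn_integral_mono) (auto simp: h_def indicator_def)
        have "(\<integral>\<^sup>+x. ennreal (h x) \<partial>lebesgue)
            \<le> (\<integral>\<^sup>+x\<in>cball z R. ennreal (H x) \<partial>lebesgue)"
          by (intro nn_integral_mono) (auto simp: h_def indicator_def)
        also have "\<dots> \<le> ennreal C * ennreal (R powr \<alpha>)"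
          by (rule A_dim_less_imp_admissible[OF C R])
        finally show "(\<integral>\<^sup>+x. ennreal (h x) \<partial>lebesgue) \<le> ennreal (C * R powr \<alpha>)"
          using C0 by (simp add: ennreal_mult)
        show "0 < C * R powr \<alpha>" using C0 R by simp
      qed (use h0 I0 p in auto)
      also have "I powr p * (C * R powr \<alpha>) powr (1 - p) = I powr p * C powr (1 - p) * R powr \<beta>"
        using C0 R p by (simp add: powr_mult powr_powr)
      finally have *: "(\<integral>\<^sup>+x. ennreal ((F x powr \<alpha>) powr p * h x) \<partial>lebesgue)
          \<le> ennreal (I powr p * C powr (1 - p) * R powr \<beta>)" .
      have "(\<integral>\<^sup>+x\<in>cball z R. ennreal (G x) \<partial>lebesgue)
          = (\<integral>\<^sup>+x. ennreal w * ennreal ((F x powr \<alpha>) powr p * h x) \<partial>lebesgue)"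
        using w h0 p
        by (intro nn_integral_cong)
          (auto simp: G_def h_def indicator_def powr_powr mult.assoc simp flip: ennreal_mult')
      also have "\<dots> = ennreal w * (\<integral>\<^sup>+x. ennreal ((F x powr \<alpha>) powr p * h x) \<partial>lebesgue)"
        by (rule nn_integral_cmult) measurable
      also have "\<dots> \<le> ennreal w * ennreal (I powr p * C powr (1 - p) * R powr \<beta>)"
        by (intro mult_left_mono *) auto
      also have "\<dots> = ennreal D * ennreal (R powr \<beta>)"
        using w by (simp add: D_def mult.assoc flip: ennreal_mult')
      finally show "(\<integral>\<^sup>+x\<in>cball z R. ennreal (G x) \<partial>lebesgue) \<le> ennreal D * ennreal (R powr \<beta>)" .
    qed
    have Gw: "weight_of_dim \<beta> G"
      unfolding weight_of_dim_def
    proof (intro conjI allI G01)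
      show "G \<in> borel_measurable lebesgue"
        unfolding G_def by measurable
      show "A_dim \<beta> G < \<infinity>"
        using GD by (auto simp: order.strict_trans1)
    qed
    have "ennreal (w * I) = ennreal w * J"
      using w I by (simp add: ennreal_mult)
    also have "\<dots> = (\<integral>\<^sup>+x. ennreal w * (ennreal (F x powr \<alpha> * H x) * indicator T x) \<partial>lebesgue)"
      unfolding J_def by (rule nn_integral_cmult[symmetric]) measurable
    also have "\<dots> = (\<integral>\<^sup>+x. ennreal (F x powr \<beta> * G x) \<partial>lebesgue)"
    proof (rule nn_integral_cong)
      fix x
      have "F x powr \<alpha> = F x powr \<beta> * F x powr (\<alpha> - \<beta>)"
        by (simp flip: powr_add)
      then show "ennreal w * (ennreal (F x powr \<alpha> * H x) * indicator T x)
          = ennreal (F x powr \<beta> * G x)"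
        using w by (auto simp: G_def indicator_def mult_ac simp flip: ennreal_mult')
    qed
    also have "\<dots> \<le> A_dim \<beta> G * M_dim_sup \<beta> F"
      by (rule nn_integral_weight_le[OF Gw]) (simp add: S)
    also have "\<dots> \<le> ennreal D * ennreal S"
      unfolding S by (intro mult_right_mono GD) auto
    finally have "w * I \<le> D * S"
      using D S by (simp flip: ennreal_mult)
    then have "I \<le> I powr p * C powr (1 - p) * S"
      using w by (simp add: D_def mult.assoc)
    \<comment> \<open>As \<open>I\<close> is positive and finite, its power \<open>p\<close> cancels
      from both sides.\<close>
    moreover have "I = I powr p * I powr (1 - p)"
      using I0 by (simp flip: powr_add)
    ultimately have "I powr (\<beta> / \<alpha>) \<le> C powr (\<beta> / \<alpha>) * S"
      using I0 p(4) by (metis mult.assoc mult_le_cancel_left_pos powr_gt_zero less_irrefl)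
    then have "(I powr (\<beta> / \<alpha>)) powr (\<alpha> / \<beta>) \<le> (C powr (\<beta> / \<alpha>) * S) powr (\<alpha> / \<beta>)"
      using \<beta> by (intro powr_mono2) auto
    then have "I \<le> C * S powr (\<alpha> / \<beta>)"
      using \<beta> I0 C0 S by (simp add: powr_mult powr_powr)
    then have "J \<le> ennreal (C * S powr (\<alpha> / \<beta>))"
      unfolding I by (rule ennreal_leI)
    then show ?thesis by (simp add: J_def T_def)
  qed
qed

section \<open>Removing the truncation and conclusion\<close>

text \<open>Continuity from below of the measure with density \<open>g\<close> along an increasing
  exhaustion of the space.\<close>

lemma nn_integral_le_of_truncated:
  fixes F :: "'a::euclidean_space \<Rightarrow> real" and g :: "'a \<Rightarrow> ennreal"
  assumes [measurable]: "F \<in> borel_measurable lebesgue" "g \<in> borel_measurable lebesgue"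
    and le: "\<And>k. 0 < k \<Longrightarrow> (\<integral>\<^sup>+x\<in>{x. F x \<le> k \<and> norm x \<le> k}. g x \<partial>lebesgue) \<le> B"
  shows "(\<integral>\<^sup>+x. g x \<partial>lebesgue) \<le> B"
proof -
  \<comment> \<open>\<open>Suc\<close> keeps every cutoff positive, as \<open>le\<close>
    requires.\<close>
  define T where "T = (\<lambda>n::nat. {x. F x \<le> real (Suc n) \<and> norm x \<le> real (Suc n)})"
  have T: "T n \<in> sets lebesgue" for n
    unfolding T_def by (rule sublevel_inter_ball_lebesgue) (rule assms)
  have UT: "(\<Union>n. T n) = UNIV"
  proof -
    have "\<exists>n. x \<in> T n" for x
    proof -
      obtain n :: nat where "max (F x) (norm x) \<le> real n"
        using real_arch_simple by blast
      then show ?thesis by (intro exI[of _ n]) (auto simp: T_def)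
    qed
    then show ?thesis by auto
  qed
  have "(\<integral>\<^sup>+x. g x \<partial>lebesgue) = emeasure (density lebesgue g) (\<Union>n. T n)"
    unfolding UT by (subst emeasure_density) auto
  also have "\<dots> = (SUP n. emeasure (density lebesgue g) (T n))"
    by (intro SUP_emeasure_incseq[symmetric]) (use T in \<open>auto simp: incseq_def T_def\<close>)
  also have "\<dots> \<le> B"
  proof (rule SUP_least)
    fix n
    show "emeasure (density lebesgue g) (T n) \<le> B"
      using le[of "real (Suc n)"] T[of n] by (simp add: emeasure_density T_def)
  qed
  finally show ?thesis .
qed

text \<open>The truncated bound holds for each \<open>C\<close> above
  \<open>A_dim \<alpha> H\<close>; letting \<open>C\<close> decrease to that value gives the claim,
  also when the value is 0.\<close>

lemma nn_integral_powr_weight_le: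
  fixes F H :: "real ^ 'n \<Rightarrow> real" and \<alpha> \<beta> S :: real
  assumes \<beta>: "0 < \<beta>" "\<beta> < \<alpha>"
    and F[measurable]: "F \<in> borel_measurable lebesgue" and F0: "\<And>x. 0 \<le> F x"
    and H: "weight_of_dim \<alpha> H"
    and S: "M_dim_sup \<beta> F = ennreal S" "0 \<le> S"
  shows "(\<integral>\<^sup>+x. ennreal (F x powr \<alpha> * H x) \<partial>lebesgue) \<le> A_dim \<alpha> H * ennreal (S powr (\<alpha> / \<beta>))"
proof -
  have [measurable]: "H \<in> borel_measurable lebesgue"
    using H by (simp add: weight_of_dim_def)
  obtain A where A: "A_dim \<alpha> H = ennreal A" "0 \<le> A"
    using H by (cases "A_dim \<alpha> H") (auto simp: weight_of_dim_def)
  have C: "(\<integral>\<^sup>+x. ennreal (F x powr \<alpha> * H x) \<partial>lebesgue) \<le> ennreal (C * S powr (\<alpha> / \<beta>))"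
    if "A < C" for C
    by (rule nn_integral_le_of_truncated[OF F])
      (use that A nn_integral_truncated_le[OF \<beta> F F0 H _ S] in \<open>auto simp: ennreal_less_iff\<close>)
  have "((\<lambda>C. ennreal (C * S powr (\<alpha> / \<beta>))) \<longlongrightarrow> ennreal (A * S powr (\<alpha> / \<beta>))) (at_right A)"
    by (intro tendsto_intros)
  then have "(\<integral>\<^sup>+x. ennreal (F x powr \<alpha> * H x) \<partial>lebesgue) \<le> ennreal (A * S powr (\<alpha> / \<beta>))"
    by (rule tendsto_lowerbound) (use C in \<open>auto simp: eventually_at_right_less intro: eventually_mono[OF eventually_at_right_less]\<close>)
  with A show ?thesis by (simp add: ennreal_mult)
qed

theorem theorem1p1:
  fixes F :: "real ^ 'n \<Rightarrow> real" and \<alpha> \<beta> :: real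
  assumes "0 < \<beta>" and "\<beta> < \<alpha>" and "\<alpha> \<le> real CARD('n)"
    and "F \<in> borel_measurable lebesgue" and "\<And>x. 0 \<le> F x"
  shows "M_dim \<alpha> F \<le> M_dim \<beta> F"
proof (cases "M_dim_sup \<beta> F")
  case (real S)
  have "M_dim_sup \<alpha> F \<le> ennreal (S powr (\<alpha> / \<beta>))"
    unfolding M_dim_sup_def
  proof (rule SUP_least)
    fix H :: "real ^ 'n \<Rightarrow> real"
    assume "H \<in> {H. weight_of_dim \<alpha> H \<and> \<not> (AE x in lebesgue. H x = 0)}"
    then have H: "weight_of_dim \<alpha> H" by simp
    let ?J = "\<integral>\<^sup>+x. ennreal (F x powr \<alpha> * H x) \<partial>lebesgue"
    have J: "?J \<le> A_dim \<alpha> H * ennreal (S powr (\<alpha> / \<beta>))"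
      using assms H real by (intro nn_integral_powr_weight_le) auto
    show "1 / A_dim \<alpha> H * ?J \<le> ennreal (S powr (\<alpha> / \<beta>))"
    \<comment> \<open>If the constant is 0, then \<open>J\<close> forces the integral to be 0, and
      infinity times 0 is 0; otherwise the constant cancels, being finite.\<close>
    proof (cases "A_dim \<alpha> H = 0")
      case False
      have "1 / A_dim \<alpha> H * ?J \<le> 1 / A_dim \<alpha> H * (A_dim \<alpha> H * ennreal (S powr (\<alpha> / \<beta>)))"
        by (intro mult_left_mono J) auto
      also have "\<dots> = ennreal (S powr (\<alpha> / \<beta>))"
        using False H
        by (simp add: weight_of_dim_def ennreal_divide_times ennreal_divide_self flip: mult.assoc)
      finally show ?thesis .
    qed (use J in simp)
  qed
  then have "ennreal_powr (M_dim_sup \<alpha> F) (1 / \<alpha>)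
      \<le> ennreal_powr (ennreal (S powr (\<alpha> / \<beta>))) (1 / \<alpha>)"
    using assms by (intro ennreal_powr_mono) auto
  also have "\<dots> = ennreal_powr (M_dim_sup \<beta> F) (1 / \<beta>)"
    using assms real by (simp add: ennreal_powr_def powr_powr)
  finally show ?thesis
    by (simp add: M_dim_def M_dim_sup_def)
next
  case top
  then show ?thesis
    by (simp add: M_dim_def ennreal_powr_def flip: M_dim_sup_def)
qed

end
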